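(* Let $C$ be a single-sorted $<\kappa$-ary clone and $(d,(e_s)_{s\in S})$ an $S$-ary diagonal pair of $C$. Then $C$ is isomorphic to the matrix product $\boxtimes_{s\in S}e_s(C)$.
   Context: $S$ is a nonzero cardinal and $\kappa>S$ an infinite cardinal; cardinals are sets of smaller ordinals. A single-sorted $<\kappa$-ary clone $C$ consists of sets $C_\lambda$ ($\lambda<\kappa$ a cardinal; any set of size $<\kappa$ may be used as an arity via a fixed bijection), projections $\pi_{(\lambda,i)}\in C_\lambda$ ($i\in\lambda$), and compositions $C_{\lambda_1}\times C_{\lambda_2}^{\lambda_1}\to C_{\lambda_2}$, $(f,(g_i)_i)\mapsto f\circ(g_i)_i$, that are associative and satisfy $\pi_{(\lambda_1,i_0)}\circ(g_i)_i=g_{i_0}$, $f\circ(\pi_{(\lambda,i)})_i=f$; clone isomorphisms are sortwise bijections preserving projections and composition. An $S$-ary diagonal pair of $C$ is $(d,(e_s)_{s\in S})$ with $d\in C_S$, $e_s\in C_1$ such that (1) $e_s\circ d=e_s\circ\pi_{(S,s)}$ for all $s$; (2) $d\circ(e_s\circ\pi_{(S,s)})_{s\in S}=d$; (3) $d\circ(\pi_{(S,0)})_{s\in S}=\pi_{(S,0)}$. For a family $(e_s)_{s\in S}$ of idempotents of $C_1$ ($e_s\circ e_s=e_s$; the $e_s$ of a diagonal pair are idempotent), the matrix product $\boxtimes_{s\in S}e_s(C)$ is the single-sorted $<\kappa$-ary clone whose sort $\lambda$ is the set of tuples $(f_s/\sim_\lambda)_{s\in S}$ with $f_s\in C_{\lambda\times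 S}$ and $e_s\circ f_s=f_s$, where $f\sim_\lambda g$ iff $f\circ(e_t\circ\pi_{(\lambda\times S,(i,t))})_{(i,t)\in\lambda\times S}=g\circ(e_t\circ\pi_{(\lambda\times S,(i,t))})_{(i,t)\in\lambda\times S}$; projections $\pi_{(\lambda,i)}=(e_s\circ\pi_{(\lambda\times S,(i,s))}/\sim_\lambda)_{s\in S}$; composition $(f_s/\sim)_s\circ((g_{i,t}/\sim)_t)_{i\in\lambda_1}=(f_s\circ(g_{i,t})_{(i,t)\in\lambda_1\times S}/\sim)_{s\in S}$. *)

theory Defs
  imports Main "HOL-Library.FuncSet"
begin

unbundle cardinal_syntax

text \<open>
  An infinite cardinal \<open>\<kappa>\<close> is a cardinal order \<open>k\<close> (a well-order of minimal order type among those
  of its size) on an arbitrary type. The elements of \<open>Field k\<close> play the role of the ordinals below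
  \<open>\<kappa>\<close>; the ordinal given by \<open>a\<close>, as the set of smaller ordinals, is \<open>underS k a\<close>. The cardinals
  below \<open>\<kappa>\<close> are thus exactly the sets \<open>underS k a\<close> that are initial ordinals, each cardinal
  \<open>\<lambda> < \<kappa>\<close> being represented exactly once.
\<close>

definition cardinals_below :: "'k rel \<Rightarrow> 'k set set" where
  "cardinals_below k = {A. \<exists>a\<in>Field k. A = underS k a \<and> Card_order (Restr k A)}"

definition ord_zero :: "'k rel \<Rightarrow> 'k" where
  "ord_zero k = wo_rel.minim k (Field k)"

definition ord_one :: "'k rel \<Rightarrow> 'k set" where
  "ord_one k = {ord_zero k}"

definition arity_of :: "'k rel \<Rightarrow> 'x set \<Rightarrow> 'k set" where
  "arity_of k X = (THE A. A \<in> cardinals_below k \<and> (\<exists>f. bij_betw f X A))"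

text \<open>A choice of bijections through which sets of size less than \<open>\<kappa>\<close> are used as arities.\<close>

definition arity_bijections :: "'k rel \<Rightarrow> ('x set \<Rightarrow> 'x \<Rightarrow> 'k) \<Rightarrow> bool" where
  "arity_bijections k b \<longleftrightarrow> (\<forall>X. |X| <o k \<longrightarrow> bij_betw (b X) X (arity_of k X))"

text \<open>
  The sorts need not be disjoint, so composition takes the two arities as arguments. Tuples
  indexed by \<open>A\<close> are extensional functions on \<open>A\<close>.
\<close>

record ('k, 'a) clone_data =
  ops :: "'k set \<Rightarrow> 'a set"
  prj :: "'k set \<Rightarrow> 'k \<Rightarrow> 'a"
  cmp :: "'k set \<Rightarrow> 'k set \<Rightarrow> 'a \<Rightarrow> ('k \<Rightarrow> 'a) \<Rightarrow> 'a"

definition clone :: "'k rel \<Rightarrow> ('k, 'a) clone_data \<Rightarrow> bool" where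
  "clone k C \<longleftrightarrow>
     (\<forall>A\<in>cardinals_below k. \<forall>i\<in>A. prj C A i \<in> ops C A) \<and>
     (\<forall>A\<in>cardinals_below k. \<forall>B\<in>cardinals_below k. \<forall>f\<in>ops C A. \<forall>g\<in>A \<rightarrow>\<^sub>E ops C B.
        cmp C A B f g \<in> ops C B) \<and>
     (\<forall>A\<in>cardinals_below k. \<forall>B\<in>cardinals_below k. \<forall>D\<in>cardinals_below k.
        \<forall>f\<in>ops C A. \<forall>g\<in>A \<rightarrow>\<^sub>E ops C B. \<forall>h\<in>B \<rightarrow>\<^sub>E ops C D.
          cmp C B D (cmp C A B f g) h = cmp C A D f (\<lambda>i\<in>A. cmp C B D (g i) h)) \<and>
     (\<forall>A\<in>cardinals_below k. \<forall>B\<in>cardinals_below k. \<forall>g\<in>A \<rightarrow>\<^sub>E ops C B. \<forall>i\<in>A.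
        cmp C A B (prj C A i) g = g i) \<and>
     (\<forall>A\<in>cardinals_below k. \<forall>f\<in>ops C A. cmp C A A f (\<lambda>i\<in>A. prj C A i) = f)"

definition clone_iso ::
  "'k rel \<Rightarrow> ('k, 'a) clone_data \<Rightarrow> ('k, 'b) clone_data \<Rightarrow> ('k set \<Rightarrow> 'a \<Rightarrow> 'b) \<Rightarrow> bool" where
  "clone_iso k C D \<phi> \<longleftrightarrow>
     (\<forall>A\<in>cardinals_below k. bij_betw (\<phi> A) (ops C A) (ops D A)) \<and>
     (\<forall>A\<in>cardinals_below k. \<forall>i\<in>A. \<phi> A (prj C A i) = prj D A i) \<and>
     (\<forall>A\<in>cardinals_below k. \<forall>B\<in>cardinals_below k. \<forall>f\<in>ops C A. \<forall>g\<in>A \<rightarrow>\<^sub>E ops C B.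
        \<phi> B (cmp C A B f g) = cmp D A B (\<phi> A f) (\<lambda>i\<in>A. \<phi> B (g i)))"

definition clone_isomorphic ::
  "'k rel \<Rightarrow> ('k, 'a) clone_data \<Rightarrow> ('k, 'b) clone_data \<Rightarrow> bool" where
  "clone_isomorphic k C D \<longleftrightarrow> (\<exists>\<phi>. clone_iso k C D \<phi>)"

definition cmp1 :: "'k rel \<Rightarrow> ('k, 'a) clone_data \<Rightarrow> 'k set \<Rightarrow> 'a \<Rightarrow> 'a \<Rightarrow> 'a" where
  "cmp1 k C B e f = cmp C (ord_one k) B e (\<lambda>_\<in>ord_one k. f)"

definition diagonal_pair ::
  "'k rel \<Rightarrow> ('k, 'a) clone_data \<Rightarrow> 'k set \<Rightarrow> 'a \<Rightarrow> ('k \<Rightarrow> 'a) \<Rightarrow> bool" where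
  "diagonal_pair k C S d e \<longleftrightarrow>
     d \<in> ops C S \<and> (\<forall>s\<in>S. e s \<in> ops C (ord_one k)) \<and>
     (\<forall>s\<in>S. cmp1 k C S (e s) d = cmp1 k C S (e s) (prj C S s)) \<and>
     cmp C S S d (\<lambda>s\<in>S. cmp1 k C S (e s) (prj C S s)) = d \<and>
     cmp C S S d (\<lambda>s\<in>S. prj C S (ord_zero k)) = prj C S (ord_zero k)"

text \<open>Projections and composition with a set \<open>X\<close> as arity, via the bijection \<open>b X\<close>.\<close>

definition set_prj ::
  "'k rel \<Rightarrow> ('x set \<Rightarrow> 'x \<Rightarrow> 'k) \<Rightarrow> ('k, 'a) clone_data \<Rightarrow> 'x set \<Rightarrow> 'x \<Rightarrow> 'a" where
  "set_prj k b C X x = prj C (arity_of k X) (b X x)"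

definition set_cmp ::
  "'k rel \<Rightarrow> ('x set \<Rightarrow> 'x \<Rightarrow> 'k) \<Rightarrow> ('k, 'a) clone_data \<Rightarrow> 'x set \<Rightarrow> 'k set \<Rightarrow> 'a \<Rightarrow> ('x \<Rightarrow> 'a) \<Rightarrow> 'a"
  where
  "set_cmp k b C X B f g =
     cmp C (arity_of k X) B f (\<lambda>j\<in>arity_of k X. g (inv_into X (b X) j))"

context
  fixes k :: "'k rel" and b :: "('k \<times> 'k) set \<Rightarrow> 'k \<times> 'k \<Rightarrow> 'k"
    and C :: "('k, 'a) clone_data" and S :: "'k set" and e :: "'k \<Rightarrow> 'a"
begin

definition mp_fixed :: "'k set \<Rightarrow> 'k \<Rightarrow> 'a set" where
  "mp_fixed A s = {f \<in> ops C (arity_of k (A \<times> S)). cmp1 k C (arity_of k (A \<times> S)) (e s) f = f}"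

definition mp_restr :: "'k set \<Rightarrow> 'a \<Rightarrow> 'a" where
  "mp_restr A f = set_cmp k b C (A \<times> S) (arity_of k (A \<times> S)) f
     (\<lambda>(i, t). cmp1 k C (arity_of k (A \<times> S)) (e t) (set_prj k b C (A \<times> S) (i, t)))"

definition mp_class :: "'k set \<Rightarrow> 'a \<Rightarrow> 'a set" where
  "mp_class A f = {g \<in> ops C (arity_of k (A \<times> S)). mp_restr A f = mp_restr A g}"

text \<open>
  The composition of the matrix product is given by a formula in representatives, which must be
  fixed by the respective idempotents.
\<close>

definition mp_rep :: "'k set \<Rightarrow> 'k \<Rightarrow> 'a set \<Rightarrow> 'a" where
  "mp_rep A s F = (SOME f. f \<in> mp_fixed A s \<and> mp_class A f = F)"

definition matrix_product :: "('k, 'k \<Rightarrow> 'a set) clone_data" where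
  "matrix_product =
     \<lparr> ops = (\<lambda>A. {(\<lambda>s\<in>S. mp_class A (f s)) | f. \<forall>s\<in>S. f s \<in> mp_fixed A s}),
       prj = (\<lambda>A i. \<lambda>s\<in>S. mp_class A
                (cmp1 k C (arity_of k (A \<times> S)) (e s) (set_prj k b C (A \<times> S) (i, s)))),
       cmp = (\<lambda>A B F G. \<lambda>s\<in>S. mp_class B
                (set_cmp k b C (A \<times> S) (arity_of k (B \<times> S)) (mp_rep A s (F s))
                   (\<lambda>(i, t). mp_rep B t (G i t)))) \<rparr>"

end

end

theory Submission
  imports Defs
begin

text \<open>
  Write \<open>D\<^sub>i = d \<circ> (\<pi>\<^bsub>(i,t)\<^esub>)\<^sub>t\<close>. The isomorphism sends an operation \<open>f\<close> of arity \<open>\<lambda>\<close> to the tuple of the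
  classes of \<open>e\<^sub>s \<circ> f \<circ> (D\<^sub>i)\<^sub>i\<close>. Condition (2) of a diagonal pair says that these representatives are in
  normal form for \<open>\<sim>\<close>. The inverse is \<open>(f\<^sub>s)\<^sub>s \<mapsto> d \<circ> (f\<^sub>s \<circ> (e\<^sub>t \<circ> \<pi>\<^sub>i)\<^bsub>(i,t)\<^esub>)\<^sub>s\<close>: one composite is the
  identity by (2) and (3), the other because (1) gives \<open>e\<^sub>t \<circ> D\<^sub>i = e\<^sub>t \<circ> \<pi>\<^bsub>(i,t)\<^esub>\<close>.
\<close>

section \<open>Cardinals below \<open>k\<close> and the arities of sets smaller than
  \<open>k\<close>\<close>

lemma cardinals_below_ordLess:
  assumes "Card_order k" "A \<in> cardinals_below k"
  shows "|A| <o k"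
  using assms unfolding cardinals_below_def by (auto intro: card_of_underS)

text \<open>Both sets are initial segments of \<open>k\<close>, hence comparable by inclusion, and
  each carries a cardinal order. A proper inclusion would give a strictly smaller order type,
  contradicting equal size.\<close>

lemma cardinals_below_unique:
  assumes k: "Card_order k" and A: "A \<in> cardinals_below k" and B: "B \<in> cardinals_below k"
    and iso: "|A| =o |B|"
  shows "A = B"
proof -
  have wo: "Well_order k" using k by (simp add: card_order_on_def)
  then interpret wo_rel k by (simp add: wo_rel_def)
  have *: "ofilter X \<and> |X| =o Restr k X" if "X \<in> cardinals_below k" for X
  proof -
    have X: "ofilter X" "Card_order (Restr k X)"
      using that underS_ofilter unfolding cardinals_below_def by auto
    have "Field (Restr k X) = X" using Field_Restr_ofilter[OF wo X(1)] .
    with card_of_Field_ordIso[OF X(2)] X(1) show ?thesis by simp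
  qed
  have "Restr k A =o Restr k B"
    using *[OF A] *[OF B] iso by (meson ordIso_symmetric ordIso_transitive)
  then have "\<not> A \<subset> B" "\<not> B \<subset> A"
    using ofilter_subset_ordLess[OF wo] *[OF A] *[OF B]
    by (meson not_ordLess_ordIso ordIso_symmetric)+
  with ofilter_linord *[OF A] *[OF B] show ?thesis by blast
qed

text \<open>A well-order shorter than \<open>k\<close> is isomorphic to \<open>k\<close> restricted
  to some \<open>underS k a\<close>. Applied to the cardinal order of \<open>X\<close>, this makes
  the restriction a cardinal order as well.\<close>

lemma cardinals_below_exists:
  assumes k: "Card_order k" and X: "|X| <o k"
  shows "\<exists>A\<in>cardinals_below k. \<exists>f. bij_betw f X A"
proof -
  have wo: "Well_order k" using k by (simp add: card_order_on_def)
  obtain a where a: "a \<in> Field k" "|X| =o Restr k (underS k a)"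
    using X ordLess_iff_ordIso_Restr[OF wo card_of_Well_order] by blast
  have co: "Card_order (Restr k (underS k a))"
    using a(2) card_of_Card_order Card_order_ordIso2 by blast
  have "Field (Restr k (underS k a)) = underS k a"
    using wo by (intro Field_Restr_ofilter wo_rel.underS_ofilter) (auto simp: wo_rel_def)
  then have "|X| =o |underS k a|"
    using card_of_Field_ordIso[OF co] a(2) by (metis ordIso_symmetric ordIso_transitive)
  then show ?thesis
    using a(1) co card_of_ordIso unfolding cardinals_below_def by blast
qed

text \<open>Existence and uniqueness of the equipotent cardinal make the description operator in
  \<open>arity_of\<close> meaningful.\<close>

lemma arity_of_cardinals_below:
  assumes k: "Card_order k" and X: "|X| <o k"
  shows "arity_of k X \<in> cardinals_below k"
proof -
  obtain A where A: "A \<in> cardinals_below k" "\<exists>f. bij_betw f X A"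
    using cardinals_below_exists[OF k X] by blast
  have uniq: "B = A" if "B \<in> cardinals_below k" "\<exists>f. bij_betw f X B" for B
  proof (rule cardinals_below_unique[OF k that(1) A(1)])
    show "|B| =o |A|"
      using that(2) A(2) card_of_ordIso by (meson ordIso_symmetric ordIso_transitive)
  qed
  have "arity_of k X = A"
    unfolding arity_of_def by (rule the_equality) (use A uniq in blast)+
  with A show ?thesis by simp
qed

lemma ord_zero_in_cardinal:
  assumes k: "Card_order k" and A: "A \<in> cardinals_below k" "A \<noteq> {}"
  shows "ord_zero k \<in> A"
proof -
  obtain x a where a: "A = underS k a" and x: "x \<in> A"
    using A unfolding cardinals_below_def by blast
  then have xa: "(x, a) \<in> k" "x \<noteq> a" by (auto simp: underS_def)
  have "wo_rel k" using k by (simp add: card_order_on_def wo_rel_def)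
  then interpret wo_rel k .
  have zx: "(ord_zero k, x) \<in> k"
    unfolding ord_zero_def using xa(1) by (intro minim_least) (auto simp: Field_def)
  \<comment> \<open>Transitivity puts zero below \<open>a\<close>. If zero were \<open>a\<close>
    itself, antisymmetry would force \<open>x = a\<close>.\<close>
  show ?thesis
    using transD[OF TRANS zx xa(1)] antisymD[OF ANTISYM _ xa(1)] zx xa(2)
    unfolding a Order_Relation.underS_def by blast
qed

lemma finite_ordLess_Cinfinite:
  assumes "Cinfinite k" "finite X"
  shows "|X| <o k"
  using assms
  by (intro Cfinite_ordLess_Cinfinite) (simp_all add: cfinite_def Field_card_of card_of_card_order_on)

text \<open>Some cardinal has exactly one element; being nonempty it contains zero, so it is
  \<open>{ord_zero k}\<close>.\<close>

lemma ord_one_cardinals_below: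
  assumes k: "Cinfinite k"
  shows "ord_one k \<in> cardinals_below k"
proof -
  obtain A f where A: "A \<in> cardinals_below k" and f: "bij_betw f {ord_zero k} A"
    using cardinals_below_exists finite_ordLess_Cinfinite[OF k, of "{ord_zero k}"] k by blast
  have "A = {f (ord_zero k)}" using f by (simp add: bij_betw_def)
  moreover have "ord_zero k \<in> A" using ord_zero_in_cardinal A k calculation by blast
  ultimately show ?thesis using A by (simp add: ord_one_def)
qed

text \<open>This is what allows \<open>A \<times> S\<close> to serve as an arity. If one factor is
  infinite, the product is no larger than the union, which stays below the infinite cardinal
  \<open>k\<close>.\<close>

lemma cardinals_below_Times_ordLess:
  assumes k: "Cinfinite k" and A: "A \<in> cardinals_below k" and B: "B \<in> cardinals_below k"
  shows "|A \<times> B| <o k"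
proof (cases "finite A \<and> finite B")
  case True
  then show ?thesis by (intro finite_ordLess_Cinfinite[OF k] finite_cartesian_product) simp_all
next
  case False
  then have "|A \<times> B| \<le>o |A \<union> B|"
    by (intro card_of_Times_ordLeq_infinite_Field)
      (auto simp: Field_card_of card_of_card_order_on intro: card_of_mono1)
  moreover have "|A \<union> B| <o k"
    using k cardinals_below_ordLess[of k A] cardinals_below_ordLess[of k B] A B
    by (simp add: card_of_Un_ordLess_infinite_Field cinfinite_def)
  ultimately show ?thesis by (rule ordLeq_ordLess_trans)
qed

section \<open>Clone laws for composition with arbitrary small sets as arities\<close>

locale set_arity_clone =
  fixes k :: "'k rel" and b :: "'x set \<Rightarrow> 'x \<Rightarrow> 'k" and C :: "('k, 'a) clone_data"
  assumes k_inf: "Cinfinite k" and b: "arity_bijections k b" and C: "clone k C"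
begin

text \<open>
  Composition that ignores the values of \<open>g\<close> outside \<open>A\<close>, so that the clone laws hold without
  extensionality side conditions.
\<close>

definition comp :: "'k set \<Rightarrow> 'k set \<Rightarrow> 'a \<Rightarrow> ('k \<Rightarrow> 'a) \<Rightarrow> 'a" where
  "comp A B f g = cmp C A B f (restrict g A)"

lemma comp_cong: "(\<And>i. i \<in> A \<Longrightarrow> g i = h i) \<Longrightarrow> comp A B f g = comp A B f h"
  unfolding comp_def using restrict_ext[of A g h] by simp

lemma prj_closed: "A \<in> cardinals_below k \<Longrightarrow> i \<in> A \<Longrightarrow> prj C A i \<in> ops C A"
  using C[unfolded clone_def, THEN conjunct1] by blast

lemma comp_closed:
  assumes "A \<in> cardinals_below k" "B \<in> cardinals_below k" "f \<in> ops C A"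
    and "\<And>i. i \<in> A \<Longrightarrow> g i \<in> ops C B"
  shows "comp A B f g \<in> ops C B"
proof -
  have "restrict g A \<in> A \<rightarrow>\<^sub>E ops C B" using assms(4) by auto
  then show ?thesis
    unfolding comp_def
    using C[unfolded clone_def, THEN conjunct2, THEN conjunct1] assms(1-3) by blast
qed

lemma comp_comp:
  assumes "A \<in> cardinals_below k" "B \<in> cardinals_below k" "D \<in> cardinals_below k" "f \<in> ops C A"
    and "\<And>i. i \<in> A \<Longrightarrow> g i \<in> ops C B" "\<And>i. i \<in> B \<Longrightarrow> h i \<in> ops C D"
  shows "comp B D (comp A B f g) h = comp A D f (\<lambda>i. comp B D (g i) h)"
proof -
  have g: "restrict g A \<in> A \<rightarrow>\<^sub>E ops C B" and h: "restrict h B \<in> B \<rightarrow>\<^sub>E ops C D"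
    using assms(5,6) by auto
  have "cmp C B D (cmp C A B f (restrict g A)) (restrict h B)
      = cmp C A D f (\<lambda>i\<in>A. cmp C B D (restrict g A i) (restrict h B))"
    using C[unfolded clone_def, THEN conjunct2, THEN conjunct2, THEN conjunct1,
        THEN bspec, THEN bspec, THEN bspec, THEN bspec, THEN bspec, THEN bspec,
        OF assms(1-4) g h] .
  moreover have "(\<lambda>i\<in>A. cmp C B D (restrict g A i) (restrict h B))
      = (\<lambda>i\<in>A. cmp C B D (g i) (restrict h B))" by auto
  ultimately show ?thesis unfolding comp_def by simp
qed

lemma comp_prj:
  assumes "A \<in> cardinals_below k" "B \<in> cardinals_below k" "i \<in> A"
    and "\<And>i. i \<in> A \<Longrightarrow> g i \<in> ops C B"
  shows "comp A B (prj C A i) g = g i"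
proof -
  have "restrict g A \<in> A \<rightarrow>\<^sub>E ops C B" using assms(4) by auto
  then have "cmp C A B (prj C A i) (restrict g A) = restrict g A i"
    using C[unfolded clone_def, THEN conjunct2, THEN conjunct2, THEN conjunct2, THEN conjunct1]
      assms(1-3) by blast
  with assms(3) show ?thesis by (simp add: comp_def)
qed

lemma comp_id: "A \<in> cardinals_below k \<Longrightarrow> f \<in> ops C A \<Longrightarrow> comp A A f (prj C A) = f"
  unfolding comp_def
  using C[unfolded clone_def, THEN conjunct2, THEN conjunct2, THEN conjunct2, THEN conjunct2]
  by simp

lemma cmp1_eq_comp: "cmp1 k C B u f = comp (ord_one k) B u (\<lambda>_. f)"
  by (simp add: cmp1_def comp_def)

lemma set_cmp_eq_comp:
  "set_cmp k b C X B f g = comp (arity_of k X) B f (\<lambda>j. g (inv_into X (b X) j))"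
  by (simp add: set_cmp_def comp_def)

lemma one: "ord_one k \<in> cardinals_below k"
  using k_inf by (rule ord_one_cardinals_below)

lemma cmp1_closed:
  "B \<in> cardinals_below k \<Longrightarrow> u \<in> ops C (ord_one k) \<Longrightarrow> f \<in> ops C B \<Longrightarrow> cmp1 k C B u f \<in> ops C B"
  unfolding cmp1_eq_comp using one by (intro comp_closed)

lemma comp_cmp1:
  assumes "B \<in> cardinals_below k" "D \<in> cardinals_below k" "u \<in> ops C (ord_one k)" "f \<in> ops C B"
    "\<And>i. i \<in> B \<Longrightarrow> h i \<in> ops C D"
  shows "comp B D (cmp1 k C B u f) h = cmp1 k C D u (comp B D f h)"
  unfolding cmp1_eq_comp using assms one by (intro comp_comp)

context
  fixes X :: "'x set" assumes X: "|X| <o k"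
begin

lemma arity: "arity_of k X \<in> cardinals_below k"
  using k_inf by (intro arity_of_cardinals_below X) simp

lemma bij: "bij_betw (b X) X (arity_of k X)"
  using X b by (simp add: arity_bijections_def)

lemma inv_in: "j \<in> arity_of k X \<Longrightarrow> inv_into X (b X) j \<in> X"
  using bij by (intro inv_into_into) (simp add: bij_betw_def)

lemma set_prj_closed: "x \<in> X \<Longrightarrow> set_prj k b C X x \<in> ops C (arity_of k X)"
  unfolding set_prj_def using bij by (intro prj_closed arity) (auto simp: bij_betw_def)

lemma set_cmp_cong:
  "(\<And>x. x \<in> X \<Longrightarrow> g x = h x) \<Longrightarrow> set_cmp k b C X B f g = set_cmp k b C X B f h"
  unfolding set_cmp_eq_comp by (intro comp_cong) (simp add: inv_in)

lemma set_cmp_closed: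
  assumes "B \<in> cardinals_below k" "f \<in> ops C (arity_of k X)"
    and "\<And>x. x \<in> X \<Longrightarrow> g x \<in> ops C B"
  shows "set_cmp k b C X B f g \<in> ops C B"
  unfolding set_cmp_eq_comp by (intro comp_closed assms arity inv_in)

text \<open>Associativity is required in mixed forms: here the inner composition has a set as arity,
  in \<open>set_cmp_comp\<close> the outer one, and in \<open>set_cmp_set_cmp\<close> both.\<close>

lemma comp_set_cmp:
  assumes "B \<in> cardinals_below k" "D \<in> cardinals_below k" "f \<in> ops C (arity_of k X)"
    and "\<And>x. x \<in> X \<Longrightarrow> g x \<in> ops C B" "\<And>i. i \<in> B \<Longrightarrow> h i \<in> ops C D"
  shows "comp B D (set_cmp k b C X B f g) h = set_cmp k b C X D f (\<lambda>x. comp B D (g x) h)"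
  unfolding set_cmp_eq_comp by (intro comp_comp assms arity inv_in)

lemma set_cmp_comp:
  assumes "A \<in> cardinals_below k" "D \<in> cardinals_below k" "f \<in> ops C A"
    and "\<And>i. i \<in> A \<Longrightarrow> g i \<in> ops C (arity_of k X)" "\<And>x. x \<in> X \<Longrightarrow> h x \<in> ops C D"
  shows "set_cmp k b C X D (comp A (arity_of k X) f g) h
    = comp A D f (\<lambda>i. set_cmp k b C X D (g i) h)"
  unfolding set_cmp_eq_comp by (intro comp_comp assms arity inv_in)

lemma set_cmp_cmp1:
  assumes "D \<in> cardinals_below k" "u \<in> ops C (ord_one k)" "f \<in> ops C (arity_of k X)"
    and "\<And>x. x \<in> X \<Longrightarrow> h x \<in> ops C D"
  shows "set_cmp k b C X D (cmp1 k C (arity_of k X) u f) h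
    = cmp1 k C D u (set_cmp k b C X D f h)"
  unfolding cmp1_eq_comp using assms one by (intro set_cmp_comp)

lemma set_cmp_prj:
  assumes "B \<in> cardinals_below k" "x \<in> X" and "\<And>x. x \<in> X \<Longrightarrow> g x \<in> ops C B"
  shows "set_cmp k b C X B (set_prj k b C X x) g = g x"
proof -
  have x: "b X x \<in> arity_of k X" "inv_into X (b X) (b X x) = x"
    using bij assms(2) by (auto simp: bij_betw_def)
  show ?thesis
    unfolding set_cmp_eq_comp set_prj_def
    using comp_prj[OF arity assms(1) x(1), of "\<lambda>j. g (inv_into X (b X) j)"] assms(3) inv_in x(2)
    by simp
qed

end

lemma set_cmp_set_cmp:
  assumes "|X| <o k" "|Y| <o k" "D \<in> cardinals_below k" "f \<in> ops C (arity_of k X)"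
    and "\<And>x. x \<in> X \<Longrightarrow> g x \<in> ops C (arity_of k Y)" "\<And>y. y \<in> Y \<Longrightarrow> h y \<in> ops C D"
  shows "set_cmp k b C Y D (set_cmp k b C X (arity_of k Y) f g) h
    = set_cmp k b C X D f (\<lambda>x. set_cmp k b C Y D (g x) h)"
  unfolding set_cmp_eq_comp[of X]
  by (intro set_cmp_comp assms arity inv_in)

end

section \<open>The conditions on a diagonal pair as rewriting rules\<close>

locale clone_diagonal_pair = set_arity_clone k b C
  for k :: "'k rel" and b :: "('k \<times> 'k) set \<Rightarrow> 'k \<times> 'k \<Rightarrow> 'k" and C :: "('k, 'a) clone_data" +
  fixes S :: "'k set" and d :: 'a and e :: "'k \<Rightarrow> 'a"
  assumes S: "S \<in> cardinals_below k" "S \<noteq> {}" and dp: "diagonal_pair k C S d e"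
begin

abbreviation "below \<equiv> cardinals_below k"
abbreviation "N A \<equiv> arity_of k (A \<times> S)"
abbreviation "pr A \<equiv> set_prj k b C (A \<times> S)"
abbreviation "sc A \<equiv> set_cmp k b C (A \<times> S)"
abbreviation "idem B s \<equiv> cmp1 k C B (e s)"
abbreviation "restr \<equiv> mp_restr k b C S e"
abbreviation "fixed \<equiv> mp_fixed k C S e"
abbreviation "cls \<equiv> mp_class k b C S e"
abbreviation "rep \<equiv> mp_rep k b C S e"
abbreviation "M \<equiv> matrix_product k b C S e"

lemma d_closed: "d \<in> ops C S" and e_closed: "s \<in> S \<Longrightarrow> e s \<in> ops C (ord_one k)"
  using dp by (auto simp: diagonal_pair_def)

lemma small: "A \<in> below \<Longrightarrow> |A \<times> S| <o k"
  using k_inf S(1) by (intro cardinals_below_Times_ordLess)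

lemma N_below: "A \<in> below \<Longrightarrow> N A \<in> below"
  by (intro arity small)

lemma zero_S: "ord_zero k \<in> S"
  using k_inf by (intro ord_zero_in_cardinal S) simp

lemma idem_closed: "B \<in> below \<Longrightarrow> s \<in> S \<Longrightarrow> f \<in> ops C B \<Longrightarrow> idem B s f \<in> ops C B"
  using e_closed by (intro cmp1_closed)

lemma pr_closed: "A \<in> below \<Longrightarrow> i \<in> A \<Longrightarrow> t \<in> S \<Longrightarrow> pr A (i, t) \<in> ops C (N A)"
  by (intro set_prj_closed small) auto

text \<open>Condition (1) after substitution: behind \<open>e s\<close>, only entry \<open>s\<close>
  of \<open>d\<close> is visible.\<close>

lemma idem_d:
  assumes "B \<in> below" "s \<in> S" "\<And>t. t \<in> S \<Longrightarrow> g t \<in> ops C B"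
  shows "idem B s (comp S B d g) = idem B s (g s)"
proof -
  have "comp S B (idem S s d) g = comp S B (idem S s (prj C S s)) g"
    using dp assms(2) by (simp add: diagonal_pair_def)
  then show ?thesis
    using assms S(1) d_closed e_closed by (simp add: comp_cmp1 prj_closed comp_prj)
qed

text \<open>Condition (2) after substitution: \<open>d\<close> sees its entry \<open>s\<close> only
  through \<open>e s\<close>.\<close>

lemma d_idem:
  assumes "B \<in> below" "\<And>t. t \<in> S \<Longrightarrow> g t \<in> ops C B"
  shows "comp S B d (\<lambda>s. idem B s (g s)) = comp S B d g"
proof -
  have "d = comp S S d (\<lambda>s. idem S s (prj C S s))"
    using dp by (simp add: diagonal_pair_def comp_def)
  then have "comp S B d g = comp S B (comp S S d (\<lambda>s. idem S s (prj C S s))) g"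
    by simp
  also have "\<dots> = comp S B d (\<lambda>s. comp S B (idem S s (prj C S s)) g)"
    using assms S(1) d_closed e_closed by (intro comp_comp) (auto intro: cmp1_closed prj_closed)
  also have "\<dots> = comp S B d (\<lambda>s. idem B s (g s))"
    using assms S(1) e_closed by (intro comp_cong) (simp add: comp_cmp1 prj_closed comp_prj)
  finally show ?thesis by simp
qed

text \<open>Condition (3) after substituting \<open>f\<close> for the variables of
  \<open>S\<close>.\<close>

lemma d_const:
  assumes "B \<in> below" "f \<in> ops C B"
  shows "comp S B d (\<lambda>_. f) = f"
proof -
  have "comp S B (comp S S d (\<lambda>_. prj C S (ord_zero k))) (\<lambda>_. f)
      = comp S B (prj C S (ord_zero k)) (\<lambda>_. f)"
    using dp by (simp add: diagonal_pair_def comp_def)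
  then show ?thesis
    using assms S(1) d_closed zero_S by (simp add: comp_comp prj_closed comp_prj)
qed

text \<open>Evaluate \<open>e s\<close> on \<open>d\<close> applied to all the \<open>e t\<close> of
  \<open>f\<close>: condition (1) yields the left side, conditions (2) and (3) the right
  side.\<close>

lemma idem_idem:
  assumes "B \<in> below" "s \<in> S" "f \<in> ops C B"
  shows "idem B s (idem B s f) = idem B s f"
proof -
  have "idem B s (comp S B d (\<lambda>t. idem B t f)) = idem B s (idem B s f)"
    using assms by (intro idem_d) (auto intro: idem_closed)
  then show ?thesis
    using assms by (simp add: d_idem d_const)
qed

section \<open>Normal forms for the relation defining the matrix product\<close>

lemma restr_eq: "restr A f = sc A (N A) f (\<lambda>(i, t). idem (N A) t (pr A (i, t)))"
  by (simp add: mp_restr_def)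

text \<open>The idempotents that \<open>restr\<close> puts on the variables move onto whatever is
  substituted for them. The rule is used in both directions.\<close>

lemma sc_restr:
  assumes "A \<in> below" "D \<in> below" "f \<in> ops C (N A)"
    and "\<And>i t. i \<in> A \<Longrightarrow> t \<in> S \<Longrightarrow> h (i, t) \<in> ops C D"
  shows "sc A D (restr A f) h = sc A D f (\<lambda>(i, t). idem D t (h (i, t)))"
proof -
  have h: "h x \<in> ops C D" if "x \<in> A \<times> S" for x using that assms(4) by auto
  have "sc A D (restr A f) h
      = sc A D f (\<lambda>x. sc A D (case x of (i, t) \<Rightarrow> idem (N A) t (pr A (i, t))) h)"
    unfolding restr_eq using assms
    by (intro set_cmp_set_cmp small) (auto intro: idem_closed pr_closed N_below)
  also have "\<dots> = sc A D f (\<lambda>(i, t). idem D t (h (i, t)))"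
  proof (intro set_cmp_cong small assms(1), clarify)
    fix i t assume it: "i \<in> A" "t \<in> S"
    have "sc A D (idem (N A) t (pr A (i, t))) h = idem D t (sc A D (pr A (i, t)) h)"
      using it assms(1,2) h by (intro set_cmp_cmp1 small e_closed pr_closed)
    also have "sc A D (pr A (i, t)) h = h (i, t)"
      using it assms(1,2) h by (intro set_cmp_prj small) auto
    finally show "sc A D (idem (N A) t (pr A (i, t))) h = idem D t (h (i, t))" .
  qed
  finally show ?thesis .
qed

lemma restr_closed: "A \<in> below \<Longrightarrow> f \<in> ops C (N A) \<Longrightarrow> restr A f \<in> ops C (N A)"
  unfolding restr_eq by (intro set_cmp_closed small) (auto intro: idem_closed pr_closed N_below)

lemma restr_restr:
  assumes "A \<in> below" "f \<in> ops C (N A)"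
  shows "restr A (restr A f) = restr A f"
proof -
  have "restr A (restr A f)
      = sc A (N A) f (\<lambda>(i, t). idem (N A) t (case (i, t) of (i, t) \<Rightarrow> idem (N A) t (pr A (i, t))))"
    using sc_restr[OF assms(1) N_below[OF assms(1)] assms(2),
        of "\<lambda>(i, t). idem (N A) t (pr A (i, t))"] assms(1)
    by (simp add: restr_eq[of A "restr A f"] idem_closed pr_closed N_below)
  also have "\<dots> = restr A f"
    unfolding restr_eq using assms
    by (intro set_cmp_cong small) (auto simp: idem_idem pr_closed N_below)
  finally show ?thesis .
qed

lemma cls_eq_iff:
  "f \<in> ops C (N A) \<Longrightarrow> g \<in> ops C (N A) \<Longrightarrow> cls A f = cls A g \<longleftrightarrow> restr A f = restr A g"
  unfolding mp_class_def by auto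

lemma fixed_iff: "f \<in> fixed A s \<longleftrightarrow> f \<in> ops C (N A) \<and> idem (N A) s f = f"
  by (simp add: mp_fixed_def)

text \<open>The representative is an arbitrary choice, so these two facts are all that later
  arguments use about it.\<close>

lemma rep_props:
  assumes "f \<in> fixed A s"
  shows "rep A s (cls A f) \<in> fixed A s" "restr A (rep A s (cls A f)) = restr A f"
proof -
  have *: "rep A s (cls A f) \<in> fixed A s \<and> cls A (rep A s (cls A f)) = cls A f"
    unfolding mp_rep_def by (rule someI[of _ f]) (use assms in simp)
  then show "rep A s (cls A f) \<in> fixed A s" by simp
  with * assms show "restr A (rep A s (cls A f)) = restr A f"
    by (metis cls_eq_iff fixed_iff)
qed

section \<open>The operations \<open>D_i\<close>, written \<open>diag A i\<close>, and the
  components of an operation\<close>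

definition diag :: "'k set \<Rightarrow> 'k \<Rightarrow> 'a" where
  "diag A i = comp S (N A) d (\<lambda>t. pr A (i, t))"

definition expand :: "'k set \<Rightarrow> 'a \<Rightarrow> 'a" where
  "expand A f = comp A (N A) f (diag A)"

lemma diag_closed: "A \<in> below \<Longrightarrow> i \<in> A \<Longrightarrow> diag A i \<in> ops C (N A)"
  unfolding diag_def using S(1) d_closed by (intro comp_closed) (auto intro: pr_closed N_below)

lemma expand_closed: "A \<in> below \<Longrightarrow> f \<in> ops C A \<Longrightarrow> expand A f \<in> ops C (N A)"
  unfolding expand_def by (intro comp_closed) (auto intro: diag_closed N_below)

lemma sc_diag:
  assumes "A \<in> below" "D \<in> below" "i \<in> A"
    and "\<And>i t. i \<in> A \<Longrightarrow> t \<in> S \<Longrightarrow> h (i, t) \<in> ops C D"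
  shows "sc A D (diag A i) h = comp S D d (\<lambda>t. h (i, t))"
proof -
  have "sc A D (diag A i) h = comp S D d (\<lambda>t. sc A D (pr A (i, t)) h)"
    unfolding diag_def using assms S(1) d_closed
    by (intro set_cmp_comp small) (auto intro: pr_closed)
  also have "\<dots> = comp S D d (\<lambda>t. h (i, t))"
    using assms by (intro comp_cong set_cmp_prj small) auto
  finally show ?thesis .
qed

lemma sc_expand:
  assumes "A \<in> below" "D \<in> below" "f \<in> ops C A"
    and "\<And>i t. i \<in> A \<Longrightarrow> t \<in> S \<Longrightarrow> h (i, t) \<in> ops C D"
  shows "sc A D (expand A f) h = comp A D f (\<lambda>i. comp S D d (\<lambda>t. h (i, t)))"
proof -
  have "sc A D (expand A f) h = comp A D f (\<lambda>i. sc A D (diag A i) h)"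
    unfolding expand_def using assms by (intro set_cmp_comp small) (auto intro: diag_closed)
  also have "\<dots> = comp A D f (\<lambda>i. comp S D d (\<lambda>t. h (i, t)))"
    using assms by (intro comp_cong sc_diag) auto
  finally show ?thesis .
qed

text \<open>When the substituted operations do not depend on \<open>t\<close>, each
  \<open>D_i\<close> collapses by \<open>d_const\<close>.\<close>

lemma sc_expand_const:
  assumes "A \<in> below" "D \<in> below" "f \<in> ops C A" and "\<And>i. i \<in> A \<Longrightarrow> g i \<in> ops C D"
  shows "sc A D (expand A f) (\<lambda>(i, t). g i) = comp A D f g"
proof -
  have "sc A D (expand A f) (\<lambda>(i, t). g i) = comp A D f (\<lambda>i. comp S D d (\<lambda>t. g i))"
    using sc_expand[OF assms(1-3), of "\<lambda>(i, t). g i"] assms(4) by simp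
  also have "\<dots> = comp A D f g"
    using assms by (intro comp_cong d_const)
  finally show ?thesis .
qed

text \<open>The idempotents added by \<open>restr\<close> stand directly inside \<open>d\<close>,
  which absorbs them by condition (2).\<close>

lemma restr_expand:
  assumes "A \<in> below" "f \<in> ops C A"
  shows "restr A (expand A f) = expand A f"
proof -
  have "restr A (expand A f)
      = comp A (N A) f (\<lambda>i. comp S (N A) d (\<lambda>t. idem (N A) t (pr A (i, t))))"
    unfolding restr_eq
    using sc_expand[OF assms(1) N_below assms(2), OF assms(1),
        of "\<lambda>(i, t). idem (N A) t (pr A (i, t))"] assms
    by (simp add: idem_closed pr_closed N_below)
  also have "\<dots> = expand A f"
    unfolding expand_def diag_def using assms
    by (intro comp_cong d_idem) (auto intro: pr_closed N_below)
  finally show ?thesis .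
qed

text \<open>\<open>restr\<close> acts on the variables and \<open>e s\<close> on the value, so
  associativity lets them commute.\<close>

lemma restr_idem:
  assumes "A \<in> below" "s \<in> S" "f \<in> ops C (N A)"
  shows "restr A (idem (N A) s f) = idem (N A) s (restr A f)"
  unfolding restr_eq using assms
  by (intro set_cmp_cmp1 small) (auto intro: e_closed idem_closed pr_closed N_below)

definition component :: "'k set \<Rightarrow> 'k \<Rightarrow> 'a \<Rightarrow> 'a" where
  "component A s f = idem (N A) s (expand A f)"

lemma restr_component:
  "A \<in> below \<Longrightarrow> s \<in> S \<Longrightarrow> f \<in> ops C A \<Longrightarrow> restr A (component A s f) = component A s f"
  by (simp add: component_def restr_idem expand_closed restr_expand)

lemma component_fixed:
  "A \<in> below \<Longrightarrow> s \<in> S \<Longrightarrow> f \<in> ops C A \<Longrightarrow> component A s f \<in> fixed A s"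
  by (simp add: component_def fixed_iff idem_closed idem_idem expand_closed N_below)

lemma component_closed:
  "A \<in> below \<Longrightarrow> s \<in> S \<Longrightarrow> f \<in> ops C A \<Longrightarrow> component A s f \<in> ops C (N A)"
  by (simp add: component_def idem_closed expand_closed N_below)

lemma sc_component_const:
  assumes "A \<in> below" "D \<in> below" "s \<in> S" "f \<in> ops C A" and "\<And>i. i \<in> A \<Longrightarrow> g i \<in> ops C D"
  shows "sc A D (component A s f) (\<lambda>(i, t). g i) = idem D s (comp A D f g)"
  unfolding component_def using assms
  by (subst set_cmp_cmp1) (auto simp: small e_closed expand_closed sc_expand_const)

section \<open>The inverse map\<close>

text \<open>Using \<open>restr A (F s)\<close> makes the value depend only on the classes. By
  \<open>sc_restr\<close> it amounts to substituting \<open>e t\<close> of the projection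
  \<open>i\<close> for the variable \<open>(i, t)\<close>.\<close>

definition collapse :: "'k set \<Rightarrow> ('k \<Rightarrow> 'a) \<Rightarrow> 'a" where
  "collapse A F = comp S A d (\<lambda>s. sc A A (restr A (F s)) (\<lambda>(i, t). prj C A i))"

lemma collapse_closed:
  assumes "A \<in> below" "\<And>s. s \<in> S \<Longrightarrow> F s \<in> ops C (N A)"
  shows "collapse A F \<in> ops C A"
  unfolding collapse_def using assms S(1) d_closed
  by (intro comp_closed set_cmp_closed small) (auto intro: prj_closed restr_closed)

text \<open>A component is already normal, and substituting projections independent of
  \<open>t\<close> turns it into \<open>e s\<close> of \<open>f\<close>. Then \<open>d\<close>
  reassembles \<open>f\<close> by (2) and (3).\<close>

lemma collapse_component:
  assumes "A \<in> below" "f \<in> ops C A"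
  shows "collapse A (\<lambda>s. component A s f) = f"
proof -
  have "collapse A (\<lambda>s. component A s f) = comp S A d (\<lambda>s. idem A s f)"
    unfolding collapse_def using assms
    by (intro comp_cong) (simp add: restr_component sc_component_const prj_closed comp_id)
  also have "\<dots> = f" using assms by (simp add: d_idem d_const)
  finally show ?thesis .
qed

lemma component_collapse:
  assumes A: "A \<in> below" and s: "s \<in> S" and F: "\<And>s. s \<in> S \<Longrightarrow> F s \<in> fixed A s"
  shows "component A s (collapse A F) = restr A (F s)"
proof -
  have Fc: "F t \<in> ops C (N A)" if "t \<in> S" for t using F[OF that] by (simp add: fixed_iff)
  let ?G = "\<lambda>s. sc A A (restr A (F s)) (\<lambda>(i, t). prj C A i)"
  have G: "?G t \<in> ops C A" if "t \<in> S" for t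
    using that Fc A by (intro set_cmp_closed small) (auto intro: prj_closed restr_closed)
  have "expand A (collapse A F) = comp S (N A) d (\<lambda>t. expand A (?G t))"
    unfolding expand_def collapse_def using G A S(1) d_closed
    by (intro comp_comp) (auto intro: diag_closed N_below)
  \<comment> \<open>Condition (1): the outer \<open>e s\<close> selects entry \<open>s\<close> of
    \<open>d\<close>.\<close>
  then have "component A s (collapse A F) = idem (N A) s (expand A (?G s))"
    unfolding component_def using A s G by (simp add: idem_d N_below expand_closed)
  also have "expand A (?G s)
      = sc A (N A) (restr A (F s)) (\<lambda>x. comp A (N A) (case x of (i, t) \<Rightarrow> prj C A i) (diag A))"
    unfolding expand_def using A s Fc
    by (intro comp_set_cmp small) (auto intro: diag_closed N_below restr_closed prj_closed)
  also have "\<dots> = sc A (N A) (restr A (F s)) (\<lambda>(i, t). diag A i)"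
    using A by (intro set_cmp_cong small) (auto simp: comp_prj diag_closed N_below)
  also have "\<dots> = sc A (N A) (F s) (\<lambda>(i, t). idem (N A) t (diag A i))"
    using A s Fc sc_restr[of A "N A" "F s" "\<lambda>(i, t). diag A i"]
    by (simp add: diag_closed N_below)
  \<comment> \<open>Condition (1) again: \<open>e t\<close> of \<open>D_i\<close> is
    \<open>e t\<close> of the projection \<open>(i, t)\<close>.\<close>
  also have "\<dots> = restr A (F s)"
    unfolding restr_eq using A
    by (intro set_cmp_cong small) (auto simp: diag_def idem_d N_below pr_closed)
  \<comment> \<open>The remaining outer \<open>e s\<close> disappears because it fixes
    \<open>F s\<close> and commutes with \<open>restr\<close>.\<close>
  also have "idem (N A) s (restr A (F s)) = restr A (F s)"
    using restr_idem[OF A s Fc[OF s]] F[OF s] by (simp add: fixed_iff)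
  finally show ?thesis .
qed

section \<open>The isomorphism onto the matrix product\<close>

definition iso :: "'k set \<Rightarrow> 'a \<Rightarrow> 'k \<Rightarrow> 'a set" where
  "iso A f = (\<lambda>s\<in>S. cls A (component A s f))"

lemma ops_M: "ops M A = {(\<lambda>s\<in>S. cls A (f s)) | f. \<forall>s\<in>S. f s \<in> fixed A s}"
  by (simp add: matrix_product_def)

lemma iso_bij:
  assumes A: "A \<in> below"
  shows "bij_betw (iso A) (ops C A) (ops M A)"
proof (rule bij_betw_imageI)
  show "inj_on (iso A) (ops C A)"
  proof (rule inj_onI)
    fix f g assume fg: "f \<in> ops C A" "g \<in> ops C A" and eq: "iso A f = iso A g"
    have "component A s f = component A s g" if "s \<in> S" for s
    proof -
      have "cls A (component A s f) = cls A (component A s g)"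
        using fun_cong[OF eq, of s] that by (simp add: iso_def)
      \<comment> \<open>Equal classes have equal normal forms, and components are their own normal
        forms.\<close>
      then show ?thesis
        using A fg that by (simp add: cls_eq_iff component_closed restr_component)
    qed
    then have "collapse A (\<lambda>s. component A s f) = collapse A (\<lambda>s. component A s g)"
      unfolding collapse_def by (intro comp_cong) simp
    then show "f = g" using A fg by (simp add: collapse_component)
  qed
  show "iso A ` ops C A = ops M A"
  proof
    show "iso A ` ops C A \<subseteq> ops M A"
      unfolding ops_M using component_fixed[OF A] by (fastforce simp: iso_def)
    show "ops M A \<subseteq> iso A ` ops C A"
    proof
      fix G assume "G \<in> ops M A"
      then obtain F where G: "G = (\<lambda>s\<in>S. cls A (F s))" and F: "\<And>s. s \<in> S \<Longrightarrow> F s \<in> fixed A s"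
        unfolding ops_M by blast
      have Fc: "F s \<in> ops C (N A)" if "s \<in> S" for s using F[OF that] by (simp add: fixed_iff)
      have "cls A (F s) = cls A (component A s (collapse A F))" if "s \<in> S" for s
        using A F Fc that
        by (simp add: component_collapse cls_eq_iff restr_closed restr_restr)
      then have "G = iso A (collapse A F)"
        unfolding G iso_def by (intro restrict_ext)
      moreover have "collapse A F \<in> ops C A" using A Fc by (intro collapse_closed)
      ultimately show "G \<in> iso A ` ops C A" by blast
    qed
  qed
qed

text \<open>Expanding the projection \<open>i\<close> gives \<open>D_i\<close>, and condition (1)
  reduces \<open>e s\<close> of \<open>D_i\<close> to \<open>e s\<close> of the projection
  \<open>(i, s)\<close>.\<close>

lemma iso_prj:
  assumes A: "A \<in> below" and i: "i \<in> A"
  shows "iso A (prj C A i) = prj M A i"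
proof -
  have "component A s (prj C A i) = idem (N A) s (pr A (i, s))" if "s \<in> S" for s
    unfolding component_def expand_def using A i that
    by (simp add: comp_prj diag_closed N_below) (simp add: diag_def idem_d N_below pr_closed)
  then show ?thesis
    by (simp add: iso_def matrix_product_def cong: restrict_cong)
qed

text \<open>The product composes chosen representatives \<open>u\<close> and \<open>v\<close>, known
  only up to normal form. It suffices to compute the normal form of their composite.\<close>

lemma iso_comp:
  assumes A: "A \<in> below" and B: "B \<in> below" and f: "f \<in> ops C A"
    and g: "\<And>i. i \<in> A \<Longrightarrow> g i \<in> ops C B"
  shows "iso B (comp A B f g) = cmp M A B (iso A f) (\<lambda>i\<in>A. iso B (g i))"
proof -
  have "cls B (component B s (comp A B f g))
      = cls B (sc A (N B) (rep A s (iso A f s)) (\<lambda>(i, t). rep B t ((\<lambda>i\<in>A. iso B (g i)) i t)))"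
    if s: "s \<in> S" for s
  proof -
    define u where "u = rep A s (cls A (component A s f))"
    define v where "v = (\<lambda>(i, t). rep B t (cls B (component B t (g i))))"
    have u: "u \<in> ops C (N A)" "restr A u = component A s f"
      using rep_props[OF component_fixed[OF A s f]] A s f
      by (simp_all add: u_def fixed_iff restr_component)
    have v: "v (i, t) \<in> ops C (N B)" "restr B (v (i, t)) = component B t (g i)"
      if "i \<in> A" "t \<in> S" for i t
      using rep_props[OF component_fixed[OF B that(2) g[OF that(1)]]] B that g
      by (simp_all add: v_def fixed_iff restr_component)
    have uv: "sc A (N B) u v \<in> ops C (N B)"
      using A B u v by (intro set_cmp_closed small N_below) auto
    have "restr B (sc A (N B) u v) = sc A (N B) u (\<lambda>x. restr B (v x))"
      unfolding restr_eq using A B u v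
      by (intro set_cmp_set_cmp small) (auto intro: idem_closed pr_closed N_below)
    also have "\<dots> = sc A (N B) u (\<lambda>(i, t). idem (N B) t (expand B (g i)))"
      using A v by (intro set_cmp_cong small) (auto simp: component_def)
    \<comment> \<open>Reading \<open>sc_restr\<close> backwards, the idempotents from the components
      of \<open>g\<close> normalize \<open>u\<close>, so the choice of \<open>u\<close> no longer
      matters.\<close>
    also have "\<dots> = sc A (N B) (restr A u) (\<lambda>(i, t). expand B (g i))"
      using sc_restr[OF A N_below u(1), OF B, of "\<lambda>(i, t). expand B (g i)"] B g
      by (simp add: expand_closed)
    \<comment> \<open>The substituted operations are now independent of \<open>t\<close>, so the
      \<open>D_i\<close> inside the component of \<open>f\<close> collapse.\<close>
    also have "\<dots> = idem (N B) s (comp A (N B) f (\<lambda>i. expand B (g i)))"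
      unfolding u(2) using A B s f g
      by (intro sc_component_const) (auto intro: expand_closed N_below)
    also have "comp A (N B) f (\<lambda>i. expand B (g i)) = expand B (comp A B f g)"
      unfolding expand_def using A B f g
      by (intro comp_comp[symmetric]) (auto intro: diag_closed N_below)
    finally have "restr B (sc A (N B) u v) = component B s (comp A B f g)"
      by (simp add: component_def)
    then have "cls B (component B s (comp A B f g)) = cls B (sc A (N B) u v)"
      using A B f g s uv by (simp add: cls_eq_iff component_closed restr_component comp_closed)
    also have "sc A (N B) u v
        = sc A (N B) (rep A s (iso A f s)) (\<lambda>(i, t). rep B t ((\<lambda>i\<in>A. iso B (g i)) i t))"
      unfolding u_def v_def using A s
      by (simp add: iso_def) (intro set_cmp_cong small, auto)
    finally show ?thesis .
  qed
  then show ?thesis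
    by (simp add: iso_def[of B "comp A B f g"] matrix_product_def cong: restrict_cong)
qed

lemma clone_iso: "clone_iso k C M iso"
  unfolding clone_iso_def
proof (intro conjI ballI)
  fix A B f g assume h: "A \<in> below" "B \<in> below" "f \<in> ops C A" and g: "g \<in> A \<rightarrow>\<^sub>E ops C B"
  \<comment> \<open>Extensionality of \<open>g\<close> identifies \<open>cmp\<close> with
    \<open>comp\<close>, which restricts its tuple.\<close>
  have "restrict g A = g" using g by (simp add: PiE_restrict)
  moreover have "g i \<in> ops C B" if "i \<in> A" for i using g that by auto
  ultimately show "iso B (cmp C A B f g) = cmp M A B (iso A f) (\<lambda>i\<in>A. iso B (g i))"
    using iso_comp[OF h, of g] by (simp add: comp_def)
qed (simp_all add: iso_bij iso_prj)

end

theorem theorem4p5: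
  fixes k :: "'k rel" and b :: "('k \<times> 'k) set \<Rightarrow> 'k \<times> 'k \<Rightarrow> 'k"
    and C :: "('k, 'a) clone_data" and S :: "'k set" and d :: 'a and e :: "'k \<Rightarrow> 'a"
  assumes "Cinfinite k"
    and "S \<in> cardinals_below k" and "S \<noteq> {}"
    and "arity_bijections k b"
    and "clone k C"
    and "diagonal_pair k C S d e"
  shows "clone_isomorphic k C (matrix_product k b C S e)"
proof -
  interpret clone_diagonal_pair k b C S d e
    using assms by unfold_locales
  show ?thesis
    unfolding clone_isomorphic_def using clone_iso by blast
qed

end
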